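(* Let $(\mathcal Q,d)$ be a Hadamard space with $\operatorname{diam}(\mathcal Q)=\infty$ and let $\tau\in\mathcal S_0^+$. For $P\in\mathcal P_{\tau'}(\mathcal Q)$, let $M(P)$ be the set of $\tau$-Fréchet means of $Y\sim P$. For $A,B\subset\mathcal Q$ define $\delta(A,B):=\sup_{a\in A,\,b\in B}d(a,b)$. (i) Assume $\lim_{x\to\infty}\tau'(x)<\infty$. Then $\mathcal P_{\tau'}(\mathcal Q)=\mathcal P_0(\mathcal Q)$ and, for all $P\in\mathcal P_0(\mathcal Q)$, the breakdown point satisfies $\varepsilon(P,\delta,\mathcal P_0(\mathcal Q),M)=\frac12$. (ii) Assume $\lim_{x\to\infty}\tau'(x)=\infty$. Then, for all $P\in\mathcal P_{\tau'}(\mathcal Q)$, $\varepsilon(P,\delta,\mathcal P_{\tau'}(\mathcal Q),M)=0$.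
   Context: A Hadamard space is a nonempty complete metric space $(\mathcal Q,d)$ such that for all $y_0,y_1\in\mathcal Q$ there is $p\in\mathcal Q$ with $\frac12 d(y_0,q)^2+\frac12 d(y_1,q)^2-\frac14 d(y_0,y_1)^2\ge d(q,p)^2$ for all $q\in\mathcal Q$; it carries its Borel $\sigma$-algebra. $\mathcal S_0^+$ is the set of nondecreasing convex functions $\tau\colon[0,\infty)\to\mathbb R$ with $\tau(0)=0$ that are differentiable on $(0,\infty)$ with concave derivative $\tau'$ satisfying $\tau'(x)>0$ for all $x>0$; $\tau'(0):=\lim_{x\searrow0}\tau'(x)$. $\mathcal P_0(\mathcal Q)$ is the set of all Borel probability distributions on $\mathcal Q$ concentrated on a separable set. $\mathcal P_{\tau'}(\mathcal Q)$ is the set of all $P\in\mathcal P_0(\mathcal Q)$ with $\mathbf E[\tau'(d(Y,q))]<\infty$ for one (and hence all) $q\in\mathcal Q$, where $Y\sim P$. The set of $\tau$-Fréchet means of $Y$ is $\arg\min_{q\in\mathcal Q}\mathbf E[\tau(d(Y,q))-\tau(d(Y,o))]$, where $o\in\mathcal Q$ is an arbitrary reference point (the set does not depend on $o$). For $\epsilon>0$, an $\epsilon$-contamination of a probability distribution $P$ on $\mathcal Q$ is any probability distribution $\tilde P=\check P+\mu$, where $\check P$ is a measure with $\check P(\mathcal Q)=1-\epsilon$ and $\check P(B)\le P(B)$ for all measurable $B\subset\mathcal Q$, and $\mu$ is a measure with $\mu(\mathcal Q)=\epsilon$. For a set $\mathcal P$ of probability distributions, a map $T$ on $\mathcal P$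 and a function $\delta$ on pairs of values of $T$ with values in $[0,\infty]$, the breakdown point of $T$ at $P\in\mathcal P$ is $$\varepsilon(P,\delta,\mathcal P,T):=\inf\Big\{\epsilon>0\;\Big|\;\sup\big\{\delta(T(P),T(\tilde P))\,\big|\,\tilde P\in\mathcal P\text{ is an }\epsilon\text{-contamination of }P\big\}=\infty\Big\}.$$ *)

theory Defs
  imports "HOL-Probability.Probability"
begin

text \<open>Types are nonempty, so nonemptiness of a Hadamard space needs no assumption.\<close>

class hadamard_space = complete_space +
  assumes hadamard_midpoint:
    "\<exists>p. \<forall>q. (dist y0 q)\<^sup>2 / 2 + (dist y1 q)\<^sup>2 / 2 - (dist y0 y1)\<^sup>2 / 4 \<ge> (dist q p)\<^sup>2"

text \<open>Functions on \<open>[0,\<infinity>)\<close> are represented by total functions on the reals; only their values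
  on \<open>[0,\<infinity>)\<close> matter below.\<close>

definition S0plus :: "(real \<Rightarrow> real) set" where
  "S0plus = {\<tau>. mono_on {0..} \<tau> \<and> convex_on {0..} \<tau> \<and> \<tau> 0 = 0 \<and>
     (\<forall>x>0. \<tau> differentiable (at x)) \<and>
     concave_on {0<..} (deriv \<tau>) \<and>
     (\<forall>x>0. deriv \<tau> x > 0)}"

text \<open>The derivative \<open>\<tau>'\<close> on \<open>[0,\<infinity>)\<close>, extended to \<open>0\<close> by its right limit. On \<open>S0plus\<close> this
  limit exists, as \<open>\<tau>'\<close> is nonnegative and nondecreasing. Values at negative arguments are
  irrelevant.\<close>

definition tau_deriv :: "(real \<Rightarrow> real) \<Rightarrow> real \<Rightarrow> real" where
  "tau_deriv \<tau> x = (if x > 0 then deriv \<tau> x else Lim (at_right 0) (deriv \<tau>))"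

definition P0 :: "'a::metric_space measure set" where
  "P0 = {P. sets P = sets borel \<and> prob_space P \<and>
     (\<exists>S. separable_space (top_of_set S) \<and> (AE y in P. y \<in> S))}"

definition P_tau' :: "(real \<Rightarrow> real) \<Rightarrow> 'a::metric_space measure set" where
  "P_tau' \<tau> = {P \<in> P0. \<exists>q. (\<integral>\<^sup>+ y. ennreal (tau_deriv \<tau> (dist y q)) \<partial>P) < \<infinity>}"

text \<open>The parameter \<open>z\<close> is the reference point. For \<open>\<tau>\<close> in \<open>S0plus\<close> and \<open>P\<close> in \<open>P_tau' \<tau>\<close> the
  integrand is integrable, so the Bochner integral is the actual expectation.\<close>

definition frechet_means ::
    "(real \<Rightarrow> real) \<Rightarrow> 'a::metric_space \<Rightarrow> 'a measure \<Rightarrow> 'a set" where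
  "frechet_means \<tau> z P =
     {q. is_arg_min (\<lambda>q. \<integral>y. \<tau> (dist y q) - \<tau> (dist y z) \<partial>P) (\<lambda>_. True) q}"

definition contamination ::
    "real \<Rightarrow> 'a::topological_space measure \<Rightarrow> 'a measure \<Rightarrow> bool" where
  "contamination \<epsilon> P Pt \<longleftrightarrow>
     sets Pt = sets borel \<and> prob_space Pt \<and>
     (\<exists>Pc \<mu>. sets Pc = sets borel \<and> finite_measure Pc \<and> measure Pc UNIV = 1 - \<epsilon> \<and>
        (\<forall>B\<in>sets borel. emeasure Pc B \<le> emeasure P B) \<and>
        sets \<mu> = sets borel \<and> finite_measure \<mu> \<and> measure \<mu> UNIV = \<epsilon> \<and>
        (\<forall>B\<in>sets borel. emeasure Pt B = emeasure Pc B + emeasure \<mu> B))"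

text \<open>Suprema and infima are taken in \<open>[0,\<infinity>]\<close>, so the supremum over the empty set is \<open>0\<close> and
  the infimum over the empty set is \<open>\<infinity>\<close>.\<close>

definition breakdown_point ::
    "'a::topological_space measure \<Rightarrow> ('b \<Rightarrow> 'b \<Rightarrow> ennreal) \<Rightarrow> 'a measure set \<Rightarrow>
      ('a measure \<Rightarrow> 'b) \<Rightarrow> ennreal" where
  "breakdown_point P \<delta> \<P> T =
     Inf {ennreal \<epsilon> | \<epsilon>. \<epsilon> > 0 \<and>
       Sup {\<delta> (T P) (T Pt) | Pt. Pt \<in> \<P> \<and> contamination \<epsilon> P Pt} = \<infinity>}"

definition delta_sup :: "'a::metric_space set \<Rightarrow> 'a set \<Rightarrow> ennreal" where
  "delta_sup A B = (SUP a\<in>A. SUP b\<in>B. ennreal (dist a b))"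

text \<open>Unlike \<^const>\<open>diameter\<close>, which is real-valued and \<open>0\<close> on unbounded sets, this is the
  diameter with values in \<open>[0,\<infinity>]\<close>.\<close>

definition ext_diameter :: "'a::metric_space set \<Rightarrow> ennreal" where
  "ext_diameter A = (SUP x\<in>A. SUP y\<in>A. ennreal (dist x y))"

end

theory Submission
  imports Defs
begin

text \<open>
  Write \<open>F\<close> for the expected cost. It is midpoint convex, continuous and coercive, because distances are
  convex in a Hadamard space and \<open>\<tau>\<close> is convex and nondecreasing. Such functions have minimisers
  (\<open>hadamard_minimiser_exists\<close>), so the sets of Frechet means are nonempty and unboundedness of the means
  is visible to \<open>delta_sup\<close>.

  The derivative \<open>\<tau>'\<close> measures how strongly a point at a given distance pulls at the mean. If \<open>\<tau>'\<close> has
  the finite limit \<open>L\<close>, all far away points pull with almost the same force \<open>L\<close>, and the majority wins: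
  when a ball carries more than half of the mass, the means are within a distance of its centre that depends
  only on its radius and its share (\<open>frechet_mean_near_majority\<close>). This one estimate gives both bounds for
  the breakdown point. For \<open>\<epsilon> < 1/2\<close> the majority is a large ball that the uncontaminated distribution
  almost fills, and the means stay bounded. For \<open>\<epsilon> > 1/2\<close> the majority is the contaminating point mass,
  a ball of radius zero about a point that may be placed arbitrarily far away, and the means follow it.

  If \<open>\<tau>'\<close> tends to infinity, one far point beats everything else, whatever its weight. At a mean
  near the original distribution a short step towards that point would cost a bounded multiple of the
  step length and gain an arbitrarily large one (\<open>breakdown_unbounded_slope\<close>).
\<close>

section \<open>Functions in the class S0plus\<close>

text \<open>The derivative, set to \<open>0\<close> on \<open>(-\<infinity>, 0]\<close>. Since \<open>\<tau>\<close> is minimal at \<open>0\<close>, the value \<open>0\<close> is a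
  subgradient there relative to \<open>[0,\<infinity>)\<close>, so the tangent inequality below covers all of \<open>[0,\<infinity>)\<close>
  without a case distinction. The function is monotone on the whole real line, hence Borel.\<close>

definition slope :: "(real \<Rightarrow> real) \<Rightarrow> real \<Rightarrow> real" where
  "slope \<tau> x = (if x > 0 then deriv \<tau> x else 0)"

lemma tau_deriv_eq_slope: "x > 0 \<Longrightarrow> tau_deriv \<tau> x = slope \<tau> x"
  by (simp add: tau_deriv_def slope_def)

lemma S0plus_mono: "\<tau> \<in> S0plus \<Longrightarrow> 0 \<le> x \<Longrightarrow> x \<le> y \<Longrightarrow> \<tau> x \<le> \<tau> y"
  by (auto simp: S0plus_def monotone_on_def)

lemma S0plus_nonneg: "\<tau> \<in> S0plus \<Longrightarrow> 0 \<le> x \<Longrightarrow> 0 \<le> \<tau> x"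
  using S0plus_mono[of \<tau> 0 x] by (simp add: S0plus_def)

lemma S0plus_subgradient:
  assumes "\<tau> \<in> S0plus" "0 \<le> a" "0 \<le> b"
  shows "\<tau> b + slope \<tau> b * (a - b) \<le> \<tau> a"
proof (cases "b = 0")
  case True
  have "\<tau> 0 = 0" using assms(1) by (simp add: S0plus_def)
  then show ?thesis using True S0plus_nonneg[OF assms(1,2)] by (simp add: slope_def)
next
  case False
  then have b: "b > 0" using assms by simp
  have cvx: "convex_on {0..} \<tau>" using assms(1) by (simp add: S0plus_def)
  have "\<tau> differentiable (at b)" using assms(1) b by (simp add: S0plus_def)
  then have "(\<tau> has_field_derivative deriv \<tau> b) (at b)"
    by (simp add: DERIV_deriv_iff_real_differentiable)
  then have der: "(\<tau> has_field_derivative deriv \<tau> b) (at b within {0..})"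
    by (rule has_field_derivative_at_within)
  have "b \<in> interior {0..}" using b by (simp add: interior_real_atLeast)
  from convex_on_imp_above_tangent[OF cvx _ this _ der, of a] \<open>0 \<le> a\<close>
  show ?thesis using b by (simp add: slope_def connected_Ici)
qed

lemma slope_pos: "\<tau> \<in> S0plus \<Longrightarrow> x > 0 \<Longrightarrow> slope \<tau> x > 0"
  by (simp add: S0plus_def slope_def)

lemma slope_nonneg: "\<tau> \<in> S0plus \<Longrightarrow> 0 \<le> slope \<tau> x"
  by (cases "x > 0") (auto simp: S0plus_def slope_def less_imp_le)

lemma slope_mono: assumes "\<tau> \<in> S0plus" shows "mono (slope \<tau>)"
proof (rule monoI)
  fix x y :: real assume "x \<le> y"
  show "slope \<tau> x \<le> slope \<tau> y"
  proof (cases "0 < x \<and> x < y")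
    case True
    have "\<tau> x + slope \<tau> x * (y - x) \<le> \<tau> y" "\<tau> y + slope \<tau> y * (x - y) \<le> \<tau> x"
      using True by (auto intro!: S0plus_subgradient assms)
    then have "slope \<tau> x * (y - x) \<le> slope \<tau> y * (y - x)" by (simp add: algebra_simps)
    then show ?thesis using True by simp
  next
    case False
    then show ?thesis using \<open>x \<le> y\<close> slope_nonneg[OF assms, of y]
      by (cases "x = y") (auto simp: slope_def)
  qed
qed

text \<open>Concavity on the three points \<open>x/2\<close>, \<open>x\<close>, \<open>2x\<close>, with \<open>x = (2/3) (x/2) + (1/3) (2x)\<close>; the term
  at \<open>x/2\<close> is positive and can be dropped.\<close>

lemma slope_doubling:
  assumes "\<tau> \<in> S0plus"
  shows "slope \<tau> (2 * x) \<le> 3 * slope \<tau> x"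
proof (cases "x > 0")
  case True
  have "concave_on {0<..} (deriv \<tau>)" using assms by (simp add: S0plus_def)
  from concave_onD[OF this, of "1/3" "x/2" "2*x"] True
  have "2/3 * deriv \<tau> (x/2) + 1/3 * deriv \<tau> (2*x) \<le> deriv \<tau> x" by simp
  moreover have "deriv \<tau> (x/2) > 0" using assms True by (simp add: S0plus_def)
  ultimately show ?thesis using True by (simp add: slope_def)
qed (simp add: slope_def)

text \<open>This replaces subadditivity of the concave derivative: the factor \<open>3\<close> is harmless and lets the
  reference point of an integrability condition be moved.\<close>

lemma slope_add:
  assumes "\<tau> \<in> S0plus"
  shows "slope \<tau> (x + y) \<le> 3 * (slope \<tau> x + slope \<tau> y)"
proof -
  have "slope \<tau> (x + y) \<le> slope \<tau> (2 * max x y)"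
    by (intro monoD[OF slope_mono[OF assms]]) simp
  also have "\<dots> \<le> 3 * slope \<tau> (max x y)" by (rule slope_doubling[OF assms])
  also have "\<dots> \<le> 3 * (slope \<tau> x + slope \<tau> y)"
    using slope_nonneg[OF assms, of x] slope_nonneg[OF assms, of y] by (auto simp: max_def)
  finally show ?thesis .
qed

lemma S0plus_lipschitz:
  assumes "\<tau> \<in> S0plus" "0 \<le> a" "0 \<le> b" "a \<le> c" "b \<le> c"
  shows "\<bar>\<tau> a - \<tau> b\<bar> \<le> slope \<tau> c * \<bar>a - b\<bar>"
proof -
  have *: "\<tau> a - \<tau> b \<le> slope \<tau> c * \<bar>a - b\<bar>" if "0 \<le> a" "0 \<le> b" "a \<le> c" for a b
  proof -
    have "\<tau> a - \<tau> b \<le> slope \<tau> a * (a - b)"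
      using S0plus_subgradient[OF assms(1), of b a] that by (simp add: algebra_simps)
    also have "\<dots> \<le> slope \<tau> a * \<bar>a - b\<bar>"
      by (intro mult_left_mono slope_nonneg assms) auto
    also have "\<dots> \<le> slope \<tau> c * \<bar>a - b\<bar>"
      by (intro mult_right_mono monoD[OF slope_mono[OF assms(1)]] that) auto
    finally show ?thesis .
  qed
  from *[of a b] *[of b a] assms show ?thesis by (auto simp: abs_minus_commute abs_le_iff)
qed

section \<open>Hadamard spaces\<close>

definition midpoint_of :: "'a::metric_space \<Rightarrow> 'a \<Rightarrow> 'a \<Rightarrow> bool" where
  "midpoint_of a b m \<longleftrightarrow>
     (\<forall>q. (dist q m)\<^sup>2 \<le> (dist a q)\<^sup>2 / 2 + (dist b q)\<^sup>2 / 2 - (dist a b)\<^sup>2 / 4)"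

lemma midpoint_exists: "\<exists>m. midpoint_of a b (m::'a::hadamard_space)"
  using hadamard_midpoint[of a b] unfolding midpoint_of_def by blast

text \<open>The distance to a fixed point is midpoint convex: bound \<open>dist a b\<close> from below by
  \<open>\<bar>dist q a - dist q b\<bar>\<close> in the midpoint inequality; the right-hand side becomes a perfect square.\<close>

lemma midpoint_dist:
  assumes "midpoint_of a b m"
  shows "dist q m \<le> (dist q a + dist q b) / 2"
proof (rule power2_le_imp_le)
  have "\<bar>dist q a - dist q b\<bar>\<^sup>2 \<le> (dist a b)\<^sup>2"
    by (intro power_mono) (use dist_triangle[of q a b] dist_triangle[of q b a] in \<open>auto simp: dist_commute abs_le_iff\<close>)
  then show "(dist q m)\<^sup>2 \<le> ((dist q a + dist q b) / 2)\<^sup>2"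
    using assms[unfolded midpoint_of_def, rule_format, of q]
    by (simp add: dist_commute power2_eq_square field_simps)
qed simp

lemma midpoint_dist_left:
  assumes "midpoint_of a b m"
  shows "dist a m \<le> dist a b / 2"
  using midpoint_dist[OF assms, of a] by simp

text \<open>Halving the segment from \<open>q\<close> to \<open>x\<close> \<open>k\<close> times, always keeping the half at \<open>q\<close>, gives points
  that lie on the segment and are as close to \<open>q\<close> as desired. They stand in for the geodesic.\<close>

lemma partial_geodesic:
  fixes q x :: "'a::hadamard_space"
  shows "\<exists>m. dist q m \<le> dist q x / 2 ^ k \<and> dist x m \<le> dist q x - dist q x / 2 ^ k"
proof (induction k)
  case 0
  show ?case by (intro exI[of _ x]) simp
next
  case (Suc k)
  then obtain m where m: "dist q m \<le> dist q x / 2 ^ k" "dist x m \<le> dist q x - dist q x / 2 ^ k"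
    by blast
  define u where "u = dist q x / 2 ^ k"
  obtain n where n: "midpoint_of q m n" using midpoint_exists by blast
  have "dist q n \<le> dist q m / 2" using midpoint_dist_left[OF n] .
  moreover have "dist x n \<le> (dist x q + dist x m) / 2" using midpoint_dist[OF n] .
  moreover have "dist q x / 2 ^ Suc k = u / 2" by (simp add: u_def)
  ultimately show ?case using m unfolding u_def[symmetric]
    by (intro exI[of _ n]) (simp add: dist_commute)
qed

text \<open>A continuous, coercive, midpoint quasi-convex function attains its minimum although bounded sets
  may fail to be compact. In the sublevel set \<open>{F \<le> inf F + e n}\<close> take a point \<open>p n\<close> almost as close to
  \<open>p0\<close> as that set allows. The midpoint of \<open>p n\<close> and \<open>p m\<close> lies in the larger of the two sublevel sets,
  so it cannot be much closer to \<open>p0\<close> than \<open>p n\<close> is. The distances to \<open>p0\<close> converge, being bounded by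
  coercivity and increasing up to \<open>e n\<close>; so \<open>p n\<close> and \<open>p m\<close> are about equally far from \<open>p0\<close>, and the
  midpoint inequality forces \<open>dist (p n) (p m)\<close> to be small. The sequence is Cauchy and its limit minimises \<open>F\<close>.\<close>

lemma hadamard_minimiser_exists:
  fixes F :: "'a::hadamard_space \<Rightarrow> real"
  assumes cont: "continuous_on UNIV F"
    and cvx: "\<And>a b m. midpoint_of a b m \<Longrightarrow> F m \<le> max (F a) (F b)"
    and coer: "\<And>q. c * dist q p0 - K \<le> F q" and c: "c > 0"
  shows "\<exists>p. \<forall>q. F p \<le> F q"
proof -
  define I where "I = Inf (range F)"
  have bdd: "bdd_below (range F)"
  proof (rule bdd_belowI2)
    fix q
    have "0 \<le> c * dist q p0" using c by simp
    then show "- K \<le> F q" using coer[of q] by linarith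
  qed
  have I_le: "I \<le> F q" for q unfolding I_def by (intro cInf_lower bdd) auto
  define e where "e n = inverse (real (Suc n))" for n
  have e0: "e n > 0" for n by (simp add: e_def)
  have e1: "e n \<le> 1" for n by (simp add: e_def inverse_le_1_iff)
  have e_dec: "e n \<le> e m" if "m \<le> n" for m n
    using that by (auto simp: e_def intro!: le_imp_inverse_le)
  have e_lim: "e \<longlonglongrightarrow> 0" unfolding e_def by (rule LIMSEQ_inverse_real_of_nat)
  define C where "C n = {q. F q \<le> I + e n}" for n
  have C_ne: "C n \<noteq> {}" for n
  proof -
    obtain q where "F q < I + e n"
      using cInf_lessD[of "range F" "I + e n"] e0[of n] by (auto simp: I_def)
    then show ?thesis unfolding C_def by (auto intro: less_imp_le)
  qed
  have C_mono: "C n \<subseteq> C m" if "m \<le> n" for m n using e_dec[OF that] by (auto simp: C_def)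
  define r where "r n = Inf (dist p0 ` C n)" for n
  have bddr: "bdd_below (dist p0 ` C n)" for n by (rule bdd_belowI2[of _ 0]) simp
  have r_le: "r n \<le> dist p0 q" if "q \<in> C n" for q n
    unfolding r_def by (intro cInf_lower bddr imageI that)
  have r0: "0 \<le> r n" for n unfolding r_def using C_ne by (intro cInf_greatest) auto
  have "\<exists>q\<in>C n. dist p0 q < r n + e n" for n
    using cInf_lessD[of "dist p0 ` C n" "r n + e n"] e0[of n] C_ne[of n] unfolding r_def by auto
  then obtain p where pC: "\<And>n. p n \<in> C n" and pr: "\<And>n. dist p0 (p n) < r n + e n" by metis
  have r_mono: "incseq r"
    unfolding r_def by (intro incseq_def[THEN iffD2] allI impI cInf_superset_mono image_mono C_mono bddr)
      (use C_ne in auto)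
  have r_bound: "r n \<le> (I + 1 + K) / c" for n
  proof -
    have "c * dist (p n) p0 - K \<le> I + 1" using coer[of "p n"] pC[of n] e1[of n] by (simp add: C_def)
    then have "dist p0 (p n) \<le> (I + 1 + K) / c" using c by (simp add: field_simps dist_commute)
    then show ?thesis using r_le[OF pC[of n]] by simp
  qed
  obtain l where l: "r \<longlonglongrightarrow> l" using incseq_convergent[OF r_mono, of "(I + 1 + K) / c"] r_bound by blast
  define s where "s n = r n + e n" for n
  have sl: "(\<lambda>n. (s n)\<^sup>2) \<longlonglongrightarrow> l\<^sup>2" unfolding s_def using tendsto_power[OF tendsto_add[OF l e_lim], of 2] by simp
  have rl: "(\<lambda>n. (r n)\<^sup>2) \<longlonglongrightarrow> l\<^sup>2" by (intro tendsto_power l)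
  have dist_pp: "(dist (p n) (p m))\<^sup>2 \<le> 2 * (s n)\<^sup>2 + 2 * (s m)\<^sup>2 - 4 * (r n)\<^sup>2" if "n \<le> m" for n m
  proof -
    obtain k where k: "midpoint_of (p n) (p m) k" using midpoint_exists by blast
    have "p m \<in> C n" using C_mono[OF that] pC by blast
    then have "k \<in> C n" using cvx[OF k] pC[of n] by (auto simp: C_def)
    then have "(r n)\<^sup>2 \<le> (dist p0 k)\<^sup>2" by (intro power_mono r_le r0)
    also have "\<dots> \<le> (dist (p n) p0)\<^sup>2 / 2 + (dist (p m) p0)\<^sup>2 / 2 - (dist (p n) (p m))\<^sup>2 / 4"
      using k by (simp add: midpoint_of_def)
    finally have 1: "(r n)\<^sup>2 \<le> (dist (p n) p0)\<^sup>2 / 2 + (dist (p m) p0)\<^sup>2 / 2 - (dist (p n) (p m))\<^sup>2 / 4" .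
    have "(dist (p n) p0)\<^sup>2 \<le> (s n)\<^sup>2" for n
      using pr[of n] by (intro power_mono) (auto simp: s_def dist_commute)
    from this[of n] this[of m] 1 show ?thesis by simp
  qed
  have "Cauchy p"
  proof (rule metric_CauchyI)
    fix \<epsilon> :: real assume "\<epsilon> > 0"
    define d where "d = \<epsilon>\<^sup>2 / 8"
    have "d > 0" using \<open>\<epsilon> > 0\<close> by (simp add: d_def)
    obtain N1 where N1: "\<And>n. n \<ge> N1 \<Longrightarrow> dist ((s n)\<^sup>2) (l\<^sup>2) < d"
      using metric_LIMSEQ_D[OF sl \<open>d > 0\<close>] by blast
    obtain N2 where N2: "\<And>n. n \<ge> N2 \<Longrightarrow> dist ((r n)\<^sup>2) (l\<^sup>2) < d"
      using metric_LIMSEQ_D[OF rl \<open>d > 0\<close>] by blast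
    have *: "dist (p n) (p m) < \<epsilon>" if "n \<ge> max N1 N2" "n \<le> m" for n m
    proof (rule power_less_imp_less_base)
      show "(dist (p n) (p m))\<^sup>2 < \<epsilon>\<^sup>2"
      proof -
        have "\<bar>(s n)\<^sup>2 - l\<^sup>2\<bar> < d" "\<bar>(s m)\<^sup>2 - l\<^sup>2\<bar> < d" "\<bar>(r n)\<^sup>2 - l\<^sup>2\<bar> < d"
          using N1[of n] N1[of m] N2[of n] that by (auto simp: dist_real_def)
        moreover have "8 * d = \<epsilon>\<^sup>2" by (simp add: d_def)
        ultimately show ?thesis using dist_pp[of n m] that by linarith
      qed
    qed (use \<open>\<epsilon> > 0\<close> in simp)
    show "\<exists>M. \<forall>m\<ge>M. \<forall>n\<ge>M. dist (p m) (p n) < \<epsilon>"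
    proof (intro exI[of _ "max N1 N2"] allI impI)
      fix m n assume "m \<ge> max N1 N2" "n \<ge> max N1 N2"
      then show "dist (p m) (p n) < \<epsilon>" using *[of m n] *[of n m] by (cases "m \<le> n") (auto simp: dist_commute)
    qed
  qed
  then obtain p' where p': "p \<longlonglongrightarrow> p'" using Cauchy_convergent convergent_def by blast
  have "(\<lambda>n. F (p n)) \<longlonglongrightarrow> F p'"
    using cont p' by (auto simp: continuous_on_def intro: tendsto_compose[of F])
  moreover have "(\<lambda>n. I + e n) \<longlonglongrightarrow> I + 0" by (intro tendsto_intros e_lim)
  ultimately have "F p' \<le> I + 0"
    by (rule LIMSEQ_le) (use pC in \<open>auto simp: C_def\<close>)
  then show ?thesis using I_le by (metis add.right_neutral order_trans)
qed

section \<open>The expected cost\<close>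

text \<open>In general only differences of costs are integrable, so the objective is handled as a function of two
  points; passing to another reference point is then mere additivity.\<close>

definition cost_diff :: "(real \<Rightarrow> real) \<Rightarrow> 'a::metric_space measure \<Rightarrow> 'a \<Rightarrow> 'a \<Rightarrow> real" where
  "cost_diff \<tau> P p q = (\<integral>y. \<tau> (dist y p) - \<tau> (dist y q) \<partial>P)"

lemma P_tau'_sets: "P \<in> P_tau' \<tau> \<Longrightarrow> sets P = sets borel"
  and P_tau'_prob: "P \<in> P_tau' \<tau> \<Longrightarrow> prob_space P"
  by (auto simp: P_tau'_def P0_def)

lemma borel_dist: "sets P = sets borel \<Longrightarrow> (\<lambda>y. dist y (q::'a::metric_space)) \<in> borel_measurable P"
  by (subst measurable_cong_sets[of P borel borel borel])
    (auto intro!: borel_measurable_continuous_onI continuous_intros)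

lemma borel_slope_dist:
  assumes "\<tau> \<in> S0plus" "sets P = sets borel"
  shows "(\<lambda>y. slope \<tau> (dist y q)) \<in> borel_measurable P"
  by (rule measurable_compose[OF borel_dist[OF assms(2)] borel_measurable_mono[OF slope_mono[OF assms(1)]]])

lemma borel_cost:
  assumes "\<tau> \<in> S0plus" "sets P = sets borel"
  shows "(\<lambda>y. \<tau> (dist y q)) \<in> borel_measurable P"
proof -
  have "mono (\<lambda>x. \<tau> (max 0 x))" by (intro monoI S0plus_mono[OF assms(1)]) auto
  from measurable_compose[OF borel_dist[OF assms(2), of q] borel_measurable_mono[OF this]]
  show ?thesis by (simp add: max_def)
qed

text \<open>Integrability at one centre passes to every centre by the triangle inequality and
  \<open>slope_add\<close>. The functions \<open>slope \<tau>\<close> and \<open>tau_deriv \<tau>\<close> can differ at distance \<open>0\<close> only,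
  where the former vanishes; so it inherits integrability.\<close>

lemma integrable_slope_dist:
  fixes P :: "'a::metric_space measure"
  assumes \<tau>: "\<tau> \<in> S0plus" and P: "P \<in> P_tau' \<tau>"
  shows "integrable P (\<lambda>y. slope \<tau> (dist y q))"
proof -
  interpret prob_space P by (rule P_tau'_prob[OF P])
  note meas = borel_slope_dist[OF \<tau> P_tau'_sets[OF P]]
  obtain q0 where q0: "(\<integral>\<^sup>+ y. ennreal (tau_deriv \<tau> (dist y q0)) \<partial>P) < \<infinity>"
    using P by (auto simp: P_tau'_def)
  have "(\<integral>\<^sup>+ y. ennreal (slope \<tau> (dist y q0)) \<partial>P) \<le> (\<integral>\<^sup>+ y. ennreal (tau_deriv \<tau> (dist y q0)) \<partial>P)"
  proof (rule nn_integral_mono)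
    fix y show "ennreal (slope \<tau> (dist y q0)) \<le> ennreal (tau_deriv \<tau> (dist y q0))"
      by (cases "y = q0") (auto simp: tau_deriv_eq_slope slope_def[of \<tau> 0])
  qed
  with q0 have "integrable P (\<lambda>y. slope \<tau> (dist y q0))"
    by (intro integrableI_nonneg meas) (auto simp: slope_nonneg \<tau>)
  then have "integrable P (\<lambda>y. 3 * (slope \<tau> (dist y q0) + slope \<tau> (dist q0 q)))" by simp
  then show ?thesis
  proof (rule Bochner_Integration.integrable_bound)
    have "slope \<tau> (dist y q) \<le> 3 * (slope \<tau> (dist y q0) + slope \<tau> (dist q0 q))" for y
      using monoD[OF slope_mono[OF \<tau>] dist_triangle[of y q q0]] slope_add[OF \<tau>]
      by (rule order_trans)
    then show "AE y in P. norm (slope \<tau> (dist y q)) \<le> norm (3 * (slope \<tau> (dist y q0) + slope \<tau> (dist q0 q)))"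
      by (simp add: slope_nonneg[OF \<tau>])
  qed (rule meas)
qed

lemma cost_increment_bound:
  assumes \<tau>: "\<tau> \<in> S0plus"
  shows "\<bar>\<tau> (dist y p) - \<tau> (dist y q)\<bar> \<le> dist p q * (3 * (slope \<tau> (dist y q) + slope \<tau> (dist p q)))"
proof -
  have t: "\<bar>dist y p - dist y q\<bar> \<le> dist p q"
    using dist_triangle[of y p q] dist_triangle[of y q p] by (auto simp: dist_commute)
  have "\<bar>\<tau> (dist y p) - \<tau> (dist y q)\<bar> \<le> slope \<tau> (dist y q + dist p q) * \<bar>dist y p - dist y q\<bar>"
    using t by (intro S0plus_lipschitz \<tau>) auto
  also have "\<dots> \<le> slope \<tau> (dist y q + dist p q) * dist p q"
    by (intro mult_left_mono t slope_nonneg \<tau>)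
  also have "\<dots> \<le> (3 * (slope \<tau> (dist y q) + slope \<tau> (dist p q))) * dist p q"
    by (intro mult_right_mono slope_add \<tau>) simp
  finally show ?thesis by (simp add: mult.commute)
qed

lemma integrable_cost_diff:
  assumes \<tau>: "\<tau> \<in> S0plus" and P: "P \<in> P_tau' \<tau>"
  shows "integrable P (\<lambda>y. \<tau> (dist y p) - \<tau> (dist y q))"
proof (rule Bochner_Integration.integrable_bound)
  interpret prob_space P by (rule P_tau'_prob[OF P])
  show "integrable P (\<lambda>y. dist p q * (3 * (slope \<tau> (dist y q) + slope \<tau> (dist p q))))"
    using integrable_slope_dist[OF \<tau> P] by simp
  show "(\<lambda>y. \<tau> (dist y p) - \<tau> (dist y q)) \<in> borel_measurable P"
    by (intro borel_measurable_diff borel_cost \<tau> P_tau'_sets[OF P])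
  show "AE y in P. norm (\<tau> (dist y p) - \<tau> (dist y q))
      \<le> norm (dist p q * (3 * (slope \<tau> (dist y q) + slope \<tau> (dist p q))))"
    by (intro AE_I2, unfold real_norm_def, rule order_trans[OF cost_increment_bound[OF \<tau>] abs_ge_self])
qed

lemma cost_diff_abs_le:
  assumes \<tau>: "\<tau> \<in> S0plus" and P: "P \<in> P_tau' \<tau>"
  shows "\<bar>cost_diff \<tau> P p q\<bar> \<le> dist p q * (3 * ((\<integral>y. slope \<tau> (dist y q) \<partial>P) + slope \<tau> (dist p q)))"
proof -
  interpret prob_space P by (rule P_tau'_prob[OF P])
  note int = integrable_slope_dist[OF \<tau> P]
  have "\<bar>cost_diff \<tau> P p q\<bar> \<le> (\<integral>y. \<bar>\<tau> (dist y p) - \<tau> (dist y q)\<bar> \<partial>P)"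
    unfolding cost_diff_def by (rule integral_abs_bound)
  also have "\<dots> \<le> (\<integral>y. dist p q * (3 * (slope \<tau> (dist y q) + slope \<tau> (dist p q))) \<partial>P)"
    using int by (intro integral_mono integrable_abs integrable_cost_diff \<tau> P cost_increment_bound) simp
  also have "\<dots> = dist p q * (3 * ((\<integral>y. slope \<tau> (dist y q) \<partial>P) + slope \<tau> (dist p q)))"
    using int by (simp add: prob_space)
  finally show ?thesis .
qed

lemma cost_diff_trans:
  assumes "\<tau> \<in> S0plus" "P \<in> P_tau' \<tau>"
  shows "cost_diff \<tau> P p q + cost_diff \<tau> P q r = cost_diff \<tau> P p r"
  unfolding cost_diff_def
  by (subst Bochner_Integration.integral_add[symmetric]) (auto intro!: integrable_cost_diff assms)

lemma frechet_means_iff: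
  assumes "\<tau> \<in> S0plus" "P \<in> P_tau' \<tau>"
  shows "q \<in> frechet_means \<tau> z P \<longleftrightarrow> (\<forall>p. 0 \<le> cost_diff \<tau> P p q)"
proof -
  have "(cost_diff \<tau> P q z \<le> cost_diff \<tau> P p z) \<longleftrightarrow> (0 \<le> cost_diff \<tau> P p q)" for p
    using cost_diff_trans[OF assms, of p q z] by linarith
  then show ?thesis
    by (auto simp: frechet_means_def is_arg_min_def cost_diff_def not_less)
qed

lemma sets_dist_greater:
  "sets P = sets borel \<Longrightarrow> {y. R < dist y (c::'a::metric_space)} \<in> sets P"
  by (auto intro!: borel_open open_Collect_less continuous_intros)

lemma integrable_tail:
  fixes u :: "'a::metric_space \<Rightarrow> real"
  assumes "sets P = sets borel" "integrable P u"
  shows "integrable P (\<lambda>y. indicator {y. R < dist y c} y * u y)"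
  using integrable_mult_indicator[OF sets_dist_greater[OF assms(1)] assms(2)] by simp

text \<open>Used with \<open>u = 1\<close>, which is tightness on balls, and with \<open>u\<close> a constant plus the derivative at
  the distance.\<close>

lemma small_tail:
  fixes u :: "'a::metric_space \<Rightarrow> real"
  assumes P: "sets P = sets borel" and u: "integrable P u" and e: "e > 0"
  shows "\<exists>R\<ge>0. (\<integral>y. indicator {y. R < dist y c} y * u y \<partial>P) < e"
proof -
  have "(\<lambda>n. \<integral>y. indicator {y. real n < dist y c} y * u y \<partial>P) \<longlonglongrightarrow> (\<integral>y. 0 \<partial>P)"
  proof (rule integral_dominated_convergence[where w="\<lambda>y. \<bar>u y\<bar>"])
    show "AE y in P. (\<lambda>n. indicator {y. real n < dist y c} y * u y) \<longlonglongrightarrow> 0"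
    proof (rule AE_I2)
      fix y
      have "eventually (\<lambda>n. dist y c \<le> real n) sequentially"
        using eventually_ge_at_top[of "nat \<lceil>dist y c\<rceil>"]
        by (rule eventually_mono) (simp add: nat_le_iff ceiling_le_iff)
      then show "(\<lambda>n. indicator {y. real n < dist y c} y * u y) \<longlonglongrightarrow> 0"
        by (intro tendsto_eventually) (auto elim!: eventually_mono)
    qed
    show "AE y in P. norm (indicator {y. real n < dist y c} y * u y) \<le> \<bar>u y\<bar>" for n
      by (auto simp: indicator_def)
    show "(\<lambda>y. indicator {y. real n < dist y c} y * u y) \<in> borel_measurable P" for n
      using integrable_tail[OF P u] by (rule borel_measurable_integrable)
  qed (use u in auto)
  from order_tendstoD(2)[OF this, of e] e
  obtain n :: nat where "(\<integral>y. indicator {y. real n < dist y c} y * u y \<partial>P) < e"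
    by (auto simp: eventually_sequentially)
  then show ?thesis by (intro exI[of _ "real n"]) simp
qed

text \<open>The quantitative heart of the argument. On the ball of radius \<open>R\<close> about \<open>c\<close> the cost at \<open>q\<close>
  grows at least with slope \<open>slope \<tau> a\<close> in \<open>dist q c\<close>, by the tangent to \<open>\<tau>\<close> at \<open>a\<close>. Outside the ball
  moving the centre from \<open>c\<close> to \<open>q\<close> can gain at most \<open>slope \<tau> (dist y c) * dist q c\<close>, by the tangent at
  \<open>dist y c\<close>. The number \<open>\<beta>\<close> bounds what the outside takes away per unit of distance: its possible
  gain, and the growth that it does not contribute.\<close>

lemma coercive_bound:
  fixes P :: "'a::metric_space measure"
  assumes \<tau>: "\<tau> \<in> S0plus" and P: "P \<in> P_tau' \<tau>" and R: "0 \<le> R" and a: "0 \<le> a"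
    and tail: "(\<integral>y. indicator {y. R < dist y c} y * (slope \<tau> a + slope \<tau> (dist y c)) \<partial>P) \<le> \<beta>"
  shows "dist q c * (slope \<tau> a - \<beta>) - (slope \<tau> a * (R + a) + \<tau> R) \<le> cost_diff \<tau> P q c"
proof -
  interpret prob_space P by (rule P_tau'_prob[OF P])
  define D where "D = dist q c"
  define s where "s = slope \<tau> a"
  define g where "g y = indicator {y. R < dist y c} y * (s + slope \<tau> (dist y c))" for y
  have D: "0 \<le> D" by (simp add: D_def)
  have s: "0 \<le> s" by (simp add: s_def slope_nonneg \<tau>)
  have g: "integrable P g" unfolding g_def
    by (intro integrable_tail P_tau'_sets[OF P] Bochner_Integration.integrable_add integrable_slope_dist \<tau> P) simp
  have tri: "D - dist y c \<le> dist y q" "dist y c - D \<le> dist y q" for y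
    using dist_triangle[of q c y] dist_triangle[of y c q] by (auto simp: D_def dist_commute)
  \<comment> \<open>The term \<open>D * g y\<close> cancels the growth claimed on the outside and pays for the largest gain there.\<close>
  have "s * (D - R - a) - \<tau> R - D * g y \<le> \<tau> (dist y q) - \<tau> (dist y c)" for y
  proof (cases "R < dist y c")
    case True
    have "slope \<tau> (dist y c) * (- D) \<le> slope \<tau> (dist y c) * (dist y q - dist y c)"
      by (intro mult_left_mono slope_nonneg \<tau>) (use tri(2)[of y] in linarith)
    also have "\<dots> \<le> \<tau> (dist y q) - \<tau> (dist y c)"
      using S0plus_subgradient[OF \<tau>, of "dist y q" "dist y c"] by simp
    finally have "slope \<tau> (dist y c) * (- D) \<le> \<tau> (dist y q) - \<tau> (dist y c)" .
    moreover have "0 \<le> s * (R + a)" "0 \<le> \<tau> R" using s R a S0plus_nonneg[OF \<tau>] by auto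
    ultimately show ?thesis using True by (simp add: g_def algebra_simps)
  next
    case False
    have "s * (D - R - a) \<le> s * (dist y q - a)"
      by (intro mult_left_mono s) (use tri(1)[of y] False in linarith)
    also have "\<dots> \<le> \<tau> (dist y q)"
      using S0plus_subgradient[OF \<tau>, of "dist y q" a] S0plus_nonneg[OF \<tau> a] a by (simp add: s_def)
    finally have "s * (D - R - a) \<le> \<tau> (dist y q)" .
    moreover have "\<tau> (dist y c) \<le> \<tau> R" using False by (intro S0plus_mono[OF \<tau>]) auto
    ultimately show ?thesis using False by (simp add: g_def)
  qed
  then have "(\<integral>y. s * (D - R - a) - \<tau> R - D * g y \<partial>P) \<le> cost_diff \<tau> P q c"
    unfolding cost_diff_def using g by (intro integral_mono integrable_cost_diff \<tau> P) auto
  moreover have "(\<integral>y. s * (D - R - a) - \<tau> R - D * g y \<partial>P) = s * (D - R - a) - \<tau> R - D * (\<integral>y. g y \<partial>P)"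
    using g by (simp add: prob_space)
  moreover have "D * (\<integral>y. g y \<partial>P) \<le> D * \<beta>"
    using tail by (intro mult_left_mono D) (simp add: g_def s_def)
  ultimately show ?thesis by (simp add: D_def s_def algebra_simps)
qed

text \<open>The function \<open>\<tau>\<close> is convex and nondecreasing, and the distance to \<open>y\<close> is midpoint convex.\<close>

lemma cost_diff_midpoint_le:
  assumes \<tau>: "\<tau> \<in> S0plus" and P: "P \<in> P_tau' \<tau>" and m: "midpoint_of a b m"
  shows "cost_diff \<tau> P m c \<le> (cost_diff \<tau> P a c + cost_diff \<tau> P b c) / 2"
proof -
  note int = integrable_cost_diff[OF \<tau> P]
  have "\<tau> (dist y m) \<le> (\<tau> (dist y a) + \<tau> (dist y b)) / 2" for y
  proof -
    define t where "t = (dist y a + dist y b) / 2"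
    define u v where "u = slope \<tau> t * (dist y a - t)" and "v = slope \<tau> t * (dist y b - t)"
    have "\<tau> (dist y m) \<le> \<tau> t"
      using midpoint_dist[OF m] by (intro S0plus_mono[OF \<tau>]) (auto simp: t_def)
    \<comment> \<open>Jensen for two points, from the tangent at their mean \<open>t\<close>.\<close>
    moreover have "\<tau> t + u \<le> \<tau> (dist y a)" "\<tau> t + v \<le> \<tau> (dist y b)"
      unfolding u_def v_def by (intro S0plus_subgradient \<tau>; simp add: t_def)+
    moreover have "u + v = 0" by (simp add: u_def v_def t_def field_simps)
    ultimately show ?thesis by argo
  qed
  moreover have "integrable P (\<lambda>y. ((\<tau> (dist y a) - \<tau> (dist y c)) + (\<tau> (dist y b) - \<tau> (dist y c))) / 2)"
    using int by (intro integrable_divide_zero Bochner_Integration.integrable_add) auto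
  ultimately have "cost_diff \<tau> P m c \<le> (\<integral>y. ((\<tau> (dist y a) - \<tau> (dist y c)) + (\<tau> (dist y b) - \<tau> (dist y c))) / 2 \<partial>P)"
    unfolding cost_diff_def using int by (intro integral_mono) (auto simp: field_simps)
  also have "\<dots> = (cost_diff \<tau> P a c + cost_diff \<tau> P b c) / 2"
    by (simp only: cost_diff_def integral_divide_zero Bochner_Integration.integral_add[OF int int])
  finally show ?thesis .
qed

lemma continuous_cost_diff:
  assumes \<tau>: "\<tau> \<in> S0plus" and P: "P \<in> P_tau' \<tau>"
  shows "continuous_on UNIV (\<lambda>q. cost_diff \<tau> P q c)"
proof (rule continuous_at_imp_continuous_on, rule ballI, unfold isCont_def)
  fix q
  define S where "S = 3 * ((\<integral>y. slope \<tau> (dist y q) \<partial>P) + slope \<tau> 1)"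
  have "((\<lambda>p. dist p q * S) \<longlongrightarrow> dist q q * S) (at q)" by (intro tendsto_intros)
  then have lim: "((\<lambda>p. dist p q * S) \<longlongrightarrow> 0) (at q)" by simp
  have "eventually (\<lambda>p. dist p q < 1) (at q)" by (auto simp: eventually_at intro: exI[of _ 1])
  then have "eventually (\<lambda>p. norm (cost_diff \<tau> P p c - cost_diff \<tau> P q c) \<le> dist p q * S) (at q)"
  proof (rule eventually_mono)
    fix p assume "dist p q < 1"
    have "\<bar>cost_diff \<tau> P p q\<bar> \<le> dist p q * (3 * ((\<integral>y. slope \<tau> (dist y q) \<partial>P) + slope \<tau> (dist p q)))"
      by (rule cost_diff_abs_le[OF \<tau> P])
    also have "\<dots> \<le> dist p q * S"
      unfolding S_def using monoD[OF slope_mono[OF \<tau>], of "dist p q" 1] \<open>dist p q < 1\<close>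
      by (intro mult_left_mono add_left_mono) auto
    finally show "norm (cost_diff \<tau> P p c - cost_diff \<tau> P q c) \<le> dist p q * S"
      using cost_diff_trans[OF \<tau> P, of p q c] by simp
  qed
  from Lim_null_comparison[OF this lim] show "((\<lambda>q. cost_diff \<tau> P q c) \<longlongrightarrow> cost_diff \<tau> P q c) (at q)"
    by (rule LIM_zero_cancel)
qed

text \<open>The cost is coercive: take the tangent at \<open>1\<close> and a ball so large that the outside consumes at
  most half of the slope \<open>slope \<tau> 1\<close>.\<close>

lemma frechet_means_nonempty:
  fixes P :: "'a::hadamard_space measure"
  assumes \<tau>: "\<tau> \<in> S0plus" and P: "P \<in> P_tau' \<tau>"
  shows "frechet_means \<tau> z P \<noteq> {}"
proof -
  interpret prob_space P by (rule P_tau'_prob[OF P])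
  have pos: "slope \<tau> 1 > 0" by (simp add: slope_pos \<tau>)
  have "integrable P (\<lambda>y. slope \<tau> 1 + slope \<tau> (dist y z))"
    by (intro Bochner_Integration.integrable_add integrable_slope_dist \<tau> P) simp
  from small_tail[OF P_tau'_sets[OF P] this, of "slope \<tau> 1 / 2" z] pos
  obtain R where R: "R \<ge> 0"
    "(\<integral>y. indicator {y. R < dist y z} y * (slope \<tau> 1 + slope \<tau> (dist y z)) \<partial>P) < slope \<tau> 1 / 2"
    by auto
  have coer: "(slope \<tau> 1 / 2) * dist q z - (slope \<tau> 1 * (R + 1) + \<tau> R) \<le> cost_diff \<tau> P q z" for q
    using coercive_bound[OF \<tau> P R(1) _ less_imp_le[OF R(2)], of q] by (simp add: mult.commute)
  have "cost_diff \<tau> P m z \<le> max (cost_diff \<tau> P a z) (cost_diff \<tau> P b z)" if "midpoint_of a b m" for a b m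
    using cost_diff_midpoint_le[OF \<tau> P that, of z] by (simp add: max_def)
  from hadamard_minimiser_exists[OF continuous_cost_diff[OF \<tau> P] this coer] pos
  obtain p where "\<forall>q. cost_diff \<tau> P p z \<le> cost_diff \<tau> P q z" by auto
  then have "p \<in> frechet_means \<tau> z P"
    by (simp add: frechet_means_def is_arg_min_def cost_diff_def not_less)
  then show ?thesis by blast
qed

section \<open>Contamination by a point mass\<close>

text \<open>The mixture \<open>\<epsilon> \<delta>\<^sub>x + (1 - \<epsilon>) P\<close>, sampled by tossing a coin; this form inherits
  measurability and integration rules from the Giry monad.\<close>

definition point_contamination :: "real \<Rightarrow> 'a::metric_space \<Rightarrow> 'a measure \<Rightarrow> 'a measure" where
  "point_contamination \<epsilon> x P =
     measure_pmf (bernoulli_pmf \<epsilon>) \<bind> (\<lambda>b. if b then return borel x else P)"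

context
  fixes P :: "'a::metric_space measure" and \<epsilon> :: real and x :: 'a
  assumes P: "sets P = sets borel" "prob_space P" and \<epsilon>: "0 < \<epsilon>" "\<epsilon> < 1"
begin

lemma measurable_coin_kernel:
  "(\<lambda>b. if b then return borel x else P) \<in> measurable (measure_pmf (bernoulli_pmf \<epsilon>)) (subprob_algebra borel)"
proof -
  have "prob_space (return borel x)" by (rule prob_space_return) simp
  then show ?thesis using P by (simp add: Pi_iff space_subprob_algebra prob_space_imp_subprob_space)
qed

lemma sets_point_contamination: "sets (point_contamination \<epsilon> x P) = sets borel"
  unfolding point_contamination_def by (rule sets_bind) (simp_all add: P)

lemma prob_space_point_contamination: "prob_space (point_contamination \<epsilon> x P)"
  unfolding point_contamination_def
  by (rule prob_space.prob_space_bind[OF prob_space_measure_pmf _ measurable_coin_kernel])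
    (simp add: P prob_space_return)

lemma nn_integral_point_contamination:
  assumes "f \<in> borel_measurable borel"
  shows "(\<integral>\<^sup>+y. f y \<partial>point_contamination \<epsilon> x P) = ennreal \<epsilon> * f x + ennreal (1 - \<epsilon>) * (\<integral>\<^sup>+y. f y \<partial>P)"
  unfolding point_contamination_def
  by (subst nn_integral_bind[OF assms measurable_coin_kernel]) (use \<epsilon> assms in \<open>simp add: nn_integral_return mult.commute\<close>)

lemma emeasure_point_contamination:
  assumes "B \<in> sets borel"
  shows "emeasure (point_contamination \<epsilon> x P) B = ennreal \<epsilon> * indicator B x + ennreal (1 - \<epsilon>) * emeasure P B"
  using nn_integral_point_contamination[of "indicator B"] assms
  by (simp add: sets_point_contamination P)

lemma measure_point_contamination:
  assumes "B \<in> sets borel"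
  shows "measure (point_contamination \<epsilon> x P) B = \<epsilon> * indicator B x + (1 - \<epsilon>) * measure P B"
proof -
  interpret prob_space P by (rule P)
  show ?thesis unfolding measure_def emeasure_point_contamination[OF assms]
    using \<epsilon> by (auto simp: emeasure_eq_measure enn2real_plus enn2real_mult indicator_def
        ennreal_mult_less_top)
qed

text \<open>Both integrability hypotheses make the positive and the negative part finite, so the rule for
  nonnegative integrals can be applied to each.\<close>

lemma integral_point_contamination:
  fixes f :: "'a \<Rightarrow> real"
  assumes f: "integrable P f" and f': "integrable (point_contamination \<epsilon> x P) f"
  shows "(\<integral>y. f y \<partial>point_contamination \<epsilon> x P) = \<epsilon> * f x + (1 - \<epsilon>) * (\<integral>y. f y \<partial>P)"
proof -
  have [measurable]: "f \<in> borel_measurable borel"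
    using borel_measurable_integrable[OF f] by (simp add: measurable_cong_sets[OF P(1) refl])
  have fin: "(\<integral>\<^sup>+y. ennreal (g y) \<partial>P) < top" if "integrable P g" for g :: "'a \<Rightarrow> real"
    using that by (simp add: real_integrable_def less_top)
  have *: "enn2real (ennreal \<epsilon> * ennreal (g x) + ennreal (1 - \<epsilon>) * (\<integral>\<^sup>+y. ennreal (g y) \<partial>P))
      = \<epsilon> * max 0 (g x) + (1 - \<epsilon>) * enn2real (\<integral>\<^sup>+y. ennreal (g y) \<partial>P)"
    if "integrable P g" for g :: "'a \<Rightarrow> real"
    using fin[OF that] \<epsilon>
    by (cases "0 \<le> g x") (simp_all add: enn2real_plus ennreal_mult_less_top enn2real_mult ennreal_neg)
  show ?thesis
    using *[OF f] *[of "\<lambda>y. - f y"] f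
    by (simp add: real_lebesgue_integral_def[OF f] real_lebesgue_integral_def[OF f']
        nn_integral_point_contamination algebra_simps max_def)
qed

lemma contamination_point_contamination: "contamination \<epsilon> P (point_contamination \<epsilon> x P)"
proof -
  let ?Pc = "scale_measure (ennreal (1 - \<epsilon>)) P" and ?\<mu> = "scale_measure (ennreal \<epsilon>) (return borel x)"
  interpret prob_space P by (rule P)
  have UNIV: "space P = UNIV" using P(1) sets_eq_imp_space_eq by fastforce
  have 1: "finite_measure ?Pc" "finite_measure ?\<mu>"
    by (rule finite_measureI, simp add: emeasure_eq_measure ennreal_mult_eq_top_iff space_scale_measure)+
  have 2: "measure ?Pc UNIV = 1 - \<epsilon>" "measure ?\<mu> UNIV = \<epsilon>"
    using \<epsilon> prob_space by (simp_all add: UNIV measure_return)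
  have 3: "ennreal (1 - \<epsilon>) * emeasure P B \<le> emeasure P B" for B
    using \<epsilon> mult_right_mono[of "ennreal (1 - \<epsilon>)" 1 "emeasure P B"] by simp
  have 4: "emeasure (point_contamination \<epsilon> x P) B = emeasure ?Pc B + emeasure ?\<mu> B"
    if "B \<in> sets borel" for B
    using that by (simp add: emeasure_point_contamination add.commute)
  show ?thesis unfolding contamination_def
    by (intro conjI sets_point_contamination prob_space_point_contamination,
        rule exI[of _ ?Pc], rule exI[of _ ?\<mu>]) (simp add: 1 2 3 4 P)
qed

end

lemma separable_space_insert:
  fixes S :: "'a::metric_space set"
  assumes "separable_space (top_of_set S)"
  shows "separable_space (top_of_set (insert x S))"
proof -
  obtain C where C: "countable C" "C \<subseteq> S" "S \<inter> closure (S \<inter> C) = S"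
    using assms by (auto simp: separable_space_def closure_of_subtopology)
  have "S \<subseteq> closure C" using C by (metis inf.absorb_iff1 inf.absorb_iff2)
  then have "insert x S \<subseteq> closure (insert x C)"
    unfolding closure_insert by blast
  moreover have "insert x S \<inter> insert x C = insert x C" using C(2) by blast
  ultimately have "top_of_set (insert x S) closure_of insert x C = insert x S"
    by (simp only: closure_of_subtopology euclidean_closure_of) blast
  then show ?thesis unfolding separable_space_def
    using C(1,2) by (intro exI[of _ "insert x C"] conjI) auto
qed

lemma point_contamination_P0:
  assumes P: "P \<in> P0" and \<epsilon>: "0 < \<epsilon>" "\<epsilon> < 1"
  shows "point_contamination \<epsilon> x P \<in> P0"
proof -
  have PP: "sets P = sets borel" "prob_space P" using P by (auto simp: P0_def)
  note pc = PP \<epsilon>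
  obtain S where S: "separable_space (top_of_set S)" "AE y in P. y \<in> S" using P by (auto simp: P0_def)
  then obtain N where N: "N \<in> null_sets P" "\<And>y. y \<in> space P - N \<Longrightarrow> y \<in> S" by (meson AE_E3)
  have NB: "N \<in> sets borel" using N(1) PP(1) by auto
  have "emeasure (point_contamination \<epsilon> x P) (N - {x}) = ennreal (1 - \<epsilon>) * emeasure P (N - {x})"
    using NB by (subst emeasure_point_contamination[OF pc]) auto
  also have "emeasure P (N - {x}) = 0"
    using N(1) NB PP(1) by (metis Diff_subset emeasure_eq_0 null_setsD1 null_setsD2)
  finally have "N - {x} \<in> null_sets (point_contamination \<epsilon> x P)"
    using NB by (auto simp: null_sets_def sets_point_contamination[OF pc])
  moreover have "space P = UNIV" using PP(1) sets_eq_imp_space_eq by fastforce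
  ultimately have "AE y in point_contamination \<epsilon> x P. y \<in> insert x S"
    using N(2) by (intro AE_I') auto
  then show ?thesis
    using separable_space_insert[OF S(1), of x] sets_point_contamination[OF pc] prob_space_point_contamination[OF pc]
    by (auto simp: P0_def)
qed

lemma point_contamination_P_tau':
  assumes \<tau>: "\<tau> \<in> S0plus" and P: "P \<in> P_tau' \<tau>" and \<epsilon>: "0 < \<epsilon>" "\<epsilon> < 1"
  shows "point_contamination \<epsilon> x P \<in> P_tau' \<tau>"
proof -
  note pc = P_tau'_sets[OF P] P_tau'_prob[OF P] \<epsilon>
  have m: "(\<lambda>y. slope \<tau> (dist y x)) \<in> borel_measurable borel" by (rule borel_slope_dist[OF \<tau> refl])
  interpret Q: prob_space "point_contamination \<epsilon> x P" by (rule prob_space_point_contamination[OF pc])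
  have "(\<integral>\<^sup>+y. ennreal (tau_deriv \<tau> (dist y x)) \<partial>point_contamination \<epsilon> x P)
     \<le> (\<integral>\<^sup>+y. ennreal (slope \<tau> (dist y x)) + ennreal \<bar>tau_deriv \<tau> 0\<bar> \<partial>point_contamination \<epsilon> x P)"
  proof (rule nn_integral_mono)
    fix y
    show "ennreal (tau_deriv \<tau> (dist y x)) \<le> ennreal (slope \<tau> (dist y x)) + ennreal \<bar>tau_deriv \<tau> 0\<bar>"
      using slope_nonneg[OF \<tau>, of "dist y x"]
      by (cases "y = x") (auto simp: tau_deriv_eq_slope ennreal_plus[symmetric] simp del: ennreal_plus intro!: ennreal_leI)
  qed
  also have "\<dots> = (\<integral>\<^sup>+y. ennreal (slope \<tau> (dist y x)) \<partial>point_contamination \<epsilon> x P) + ennreal \<bar>tau_deriv \<tau> 0\<bar>"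
    using measurable_compose[OF borel_slope_dist[OF \<tau> sets_point_contamination[OF pc]] measurable_ennreal]
    by (subst nn_integral_add) (simp_all add: Q.emeasure_space_1)
  also have "\<dots> < \<infinity>"
  proof -
    have "(\<integral>\<^sup>+y. ennreal (slope \<tau> (dist y x)) \<partial>P) < top"
      using integrableD(2)[OF integrable_slope_dist[OF \<tau> P, of x]] by (simp add: less_top)
    then show ?thesis using m
      by (subst nn_integral_point_contamination[OF pc]) (auto simp: ennreal_mult_less_top)
  qed
  finally show ?thesis
    using point_contamination_P0[OF _ \<epsilon>] P unfolding P_tau'_def by blast
qed

text \<open>The estimator breaks down at \<open>\<epsilon>\<close> as soon as a suitably placed point mass of weight \<open>\<epsilon>\<close> drives all
  Frechet means away from any given point. Existence of Frechet means matters here, because \<open>delta_sup\<close>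
  vanishes when one of its arguments is empty.\<close>

lemma breakdown_at_epsilon:
  fixes P :: "'a::hadamard_space measure"
  assumes \<tau>: "\<tau> \<in> S0plus" and P: "P \<in> P_tau' \<tau>" and \<epsilon>: "0 < \<epsilon>" "\<epsilon> < 1"
    and far: "\<And>p B. \<exists>x. \<forall>q\<in>frechet_means \<tau> z (point_contamination \<epsilon> x P). B \<le> dist p q"
  shows "breakdown_point P delta_sup (P_tau' \<tau>) (frechet_means \<tau> z) \<le> ennreal \<epsilon>"
proof -
  let ?M = "frechet_means \<tau> z"
  let ?S = "{delta_sup (?M P) (?M Pt) | Pt. Pt \<in> P_tau' \<tau> \<and> contamination \<epsilon> P Pt}"
  obtain p where p: "p \<in> ?M P" using frechet_means_nonempty[OF \<tau> P] by blast
  have "of_nat n \<le> Sup ?S" for n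
  proof -
    obtain x where x: "\<forall>q\<in>?M (point_contamination \<epsilon> x P). real n \<le> dist p q" using far by blast
    let ?Q = "point_contamination \<epsilon> x P"
    have Q: "?Q \<in> P_tau' \<tau>" by (rule point_contamination_P_tau'[OF \<tau> P \<epsilon>])
    obtain q where q: "q \<in> ?M ?Q" using frechet_means_nonempty[OF \<tau> Q] by blast
    have "of_nat n \<le> ennreal (dist p q)" using x q by (auto simp: ennreal_of_nat_eq_real_of_nat)
    also have "\<dots> \<le> delta_sup (?M P) (?M ?Q)"
      unfolding delta_sup_def by (intro SUP_upper2[OF p] SUP_upper2[OF q]) simp
    also have "\<dots> \<le> Sup ?S"
      using Q contamination_point_contamination[OF P_tau'_sets[OF P] P_tau'_prob[OF P] \<epsilon>]
      by (intro Sup_upper) blast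
    finally show ?thesis .
  qed
  then have le: "of_nat n \<le> Sup ?S" for n .
  have "Sup ?S = \<infinity>"
  proof (rule ccontr)
    assume "Sup ?S \<noteq> \<infinity>"
    then have "Sup ?S < top" unfolding infinity_ennreal_def by (rule less_top[THEN iffD1])
    then obtain n where "Sup ?S < of_nat n" using ennreal_Ex_less_of_nat by blast
    then have "\<not> of_nat n \<le> Sup ?S" by (simp only: not_le)
    then show False using le by (rule notE)
  qed
  then show ?thesis unfolding breakdown_point_def
    by (intro Inf_lower CollectI exI[of _ \<epsilon>] conjI refl \<epsilon>)
qed

lemma unbounded_space:
  assumes "ext_diameter (UNIV :: 'a::metric_space set) = \<infinity>"
  shows "\<exists>x::'a. B < dist x c"
proof (rule ccontr)
  assume "\<not> ?thesis"
  then have b: "dist x c \<le> B" for x by (auto simp: not_less)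
  have "ext_diameter (UNIV :: 'a set) \<le> ennreal (2 * B)"
    unfolding ext_diameter_def
  proof (intro SUP_least ennreal_leI)
    fix x y :: 'a show "dist x y \<le> 2 * B" using dist_triangle2[of x y c] b[of x] b[of y] by simp
  qed
  then show False using assms by (simp add: top_unique)
qed

section \<open>Bounded derivative\<close>

text \<open>If a ball carries mass at least \<open>1 - \<kappa>\<close> with \<open>\<kappa> < 1/2\<close>, and if \<open>slope \<tau> a\<close> is close enough to the
  bound \<open>L\<close>, then the pull of the ball, about \<open>(1 - \<kappa>) * slope \<tau> a\<close>, beats that of the remaining mass,
  at most \<open>\<kappa> * L\<close>. The resulting radius depends on the distribution only through \<open>R\<close> and \<open>\<kappa>\<close>,
  and not on the centre \<open>c\<close>.\<close>

lemma frechet_mean_near_majority: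
  fixes P :: "'a::metric_space measure"
  assumes \<tau>: "\<tau> \<in> S0plus" and P: "P \<in> P_tau' \<tau>" and R: "0 \<le> R" and a: "0 \<le> a"
    and L: "\<And>x. slope \<tau> x \<le> L"
    and \<kappa>: "measure P {y. R < dist y c} \<le> \<kappa>" "\<kappa> * L < (1 - \<kappa>) * slope \<tau> a"
    and q: "q \<in> frechet_means \<tau> z P"
  shows "dist c q \<le> (slope \<tau> a * (R + a) + \<tau> R) / ((1 - \<kappa>) * slope \<tau> a - \<kappa> * L)"
proof -
  interpret prob_space P by (rule P_tau'_prob[OF P])
  let ?out = "{y. R < dist y c}"
  have s: "0 \<le> slope \<tau> a" "0 \<le> L" using slope_nonneg[OF \<tau>] order_trans[OF _ L] by blast+
  have "(\<integral>y. indicator ?out y * (slope \<tau> a + slope \<tau> (dist y c)) \<partial>P) \<le> (\<integral>y. indicator ?out y * (slope \<tau> a + L) \<partial>P)"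
    by (intro integral_mono integrable_tail P_tau'_sets[OF P] Bochner_Integration.integrable_add
        integrable_slope_dist \<tau> P) (auto intro!: mult_left_mono L)
  also have "\<dots> = measure P ?out * (slope \<tau> a + L)"
    using sets_dist_greater[OF P_tau'_sets[OF P]] by simp
  also have "\<dots> \<le> \<kappa> * (slope \<tau> a + L)" using \<kappa>(1) s by (intro mult_right_mono) auto
  finally have "dist q c * (slope \<tau> a - \<kappa> * (slope \<tau> a + L)) - (slope \<tau> a * (R + a) + \<tau> R) \<le> cost_diff \<tau> P q c"
    by (rule coercive_bound[OF \<tau> P R a])
  moreover have "cost_diff \<tau> P q c \<le> 0"
  proof -
    have "0 \<le> cost_diff \<tau> P c q" using q frechet_means_iff[OF \<tau> P] by blast
    moreover have "cost_diff \<tau> P q c + cost_diff \<tau> P c q = 0"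
      using cost_diff_trans[OF \<tau> P, of q c q] by (simp add: cost_diff_def)
    ultimately show ?thesis by simp
  qed
  ultimately have "dist q c * ((1 - \<kappa>) * slope \<tau> a - \<kappa> * L) \<le> slope \<tau> a * (R + a) + \<tau> R"
    by (simp add: algebra_simps)
  then show ?thesis using \<kappa>(2) by (simp add: pos_le_divide_eq dist_commute)
qed

lemma slope_le_limit:
  assumes \<tau>: "\<tau> \<in> S0plus" and L: "(slope \<tau> \<longlongrightarrow> L) at_top"
  shows "slope \<tau> x \<le> L"
proof (rule tendsto_lowerbound[OF L])
  show "eventually (\<lambda>y. slope \<tau> x \<le> slope \<tau> y) at_top"
    using eventually_ge_at_top[of x] by (rule eventually_mono) (rule monoD[OF slope_mono[OF \<tau>]])
qed simp

lemma slope_above_fraction: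
  assumes \<tau>: "\<tau> \<in> S0plus" and L: "(slope \<tau> \<longlongrightarrow> L) at_top" and \<kappa>: "\<kappa> < 1 / 2"
  shows "\<exists>a\<ge>0. \<kappa> * L < (1 - \<kappa>) * slope \<tau> a"
proof -
  have "0 < L" using slope_pos[OF \<tau>, of 1] slope_le_limit[OF \<tau> L, of 1] by simp
  then have "\<kappa> * L < (1 - \<kappa>) * L" using \<kappa> by (intro mult_strict_right_mono) auto
  then have "\<kappa> * L / (1 - \<kappa>) < L" using \<kappa> by (simp add: pos_divide_less_eq mult.commute)
  from eventually_conj[OF order_tendstoD(1)[OF L this] eventually_ge_at_top[of 0]]
  obtain a where "\<kappa> * L / (1 - \<kappa>) < slope \<tau> a" "0 \<le> a" by (auto simp: eventually_at_top_linorder)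
  then show ?thesis using \<kappa> by (intro exI[of _ a]) (auto simp: pos_divide_less_eq mult.commute)
qed

lemma P_tau'_eq_P0:
  assumes L: "\<And>x. slope \<tau> x \<le> L"
  shows "P_tau' \<tau> = P0"
proof -
  have "(\<integral>\<^sup>+ y. ennreal (tau_deriv \<tau> (dist y q)) \<partial>P) < \<infinity>" if "P \<in> P0" for P :: "'a measure" and q
  proof -
    interpret prob_space P using that by (simp add: P0_def)
    \<comment> \<open>The maximum covers distance \<open>0\<close>, where the value of \<open>tau_deriv\<close> is a limit and not a slope.\<close>
    have "(\<integral>\<^sup>+ y. ennreal (tau_deriv \<tau> (dist y q)) \<partial>P) \<le> (\<integral>\<^sup>+ y. ennreal (max L (tau_deriv \<tau> 0)) \<partial>P)"
    proof (intro nn_integral_mono ennreal_leI)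
      fix y show "tau_deriv \<tau> (dist y q) \<le> max L (tau_deriv \<tau> 0)"
        using L[of "dist y q"] by (cases "y = q") (auto simp: tau_deriv_eq_slope)
    qed
    then show ?thesis by (simp add: emeasure_space_1 order_le_less_trans)
  qed
  then show ?thesis unfolding P_tau'_def by blast
qed

lemma contamination_measure_le:
  assumes P: "sets P = sets borel" "prob_space P" and c: "contamination \<epsilon> P Q" and B: "B \<in> sets borel"
  shows "measure Q B \<le> measure P B + \<epsilon>"
proof -
  interpret prob_space P by (rule P)
  interpret Q: prob_space Q using c by (simp add: contamination_def)
  obtain Pc \<mu> where Pc: "emeasure Pc B \<le> emeasure P B" and s: "sets \<mu> = sets borel" and
    fin: "finite_measure \<mu>" and \<mu>: "measure \<mu> UNIV = \<epsilon>"
    and Q: "emeasure Q B = emeasure Pc B + emeasure \<mu> B"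
    using c B unfolding contamination_def by blast
  interpret \<mu>: finite_measure \<mu> by (rule fin)
  have "measure \<mu> B \<le> measure \<mu> UNIV" using s by (intro \<mu>.finite_measure_mono) auto
  then have "measure \<mu> B \<le> \<epsilon>" using \<mu> by simp
  have "ennreal (measure Q B) \<le> ennreal (measure P B) + ennreal (measure \<mu> B)"
    unfolding emeasure_eq_measure[symmetric] \<mu>.emeasure_eq_measure[symmetric] Q.emeasure_eq_measure[symmetric] Q
    by (intro add_mono Pc order_refl)
  also have "\<dots> = ennreal (measure P B + measure \<mu> B)" by (rule ennreal_plus[symmetric]) auto
  finally have "measure Q B \<le> measure P B + measure \<mu> B" by (subst (asm) ennreal_le_iff) auto
  then show ?thesis using \<open>measure \<mu> B \<le> \<epsilon>\<close> by simp
qed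

text \<open>No contamination exists for \<open>\<epsilon> > 1\<close>, so breakdown is only ever shown for \<open>\<epsilon> < 1\<close>.\<close>

lemma ennreal_le_of_all_above:
  assumes "\<And>\<epsilon>. e < \<epsilon> \<Longrightarrow> \<epsilon> < 1 \<Longrightarrow> b \<le> ennreal \<epsilon>" and e: "0 \<le> e" "e < 1"
  shows "b \<le> ennreal e"
proof (rule dense_ge)
  fix t assume t: "ennreal e < t"
  show "b \<le> t"
  proof (cases t)
    case (real r)
    then have "e < r" using t e by (simp add: ennreal_less_iff)
    then have "e < min r ((e + 1) / 2)" "min r ((e + 1) / 2) < 1"
      unfolding min_less_iff_conj min_less_iff_disj using e by simp_all
    then have "b \<le> ennreal (min r ((e + 1) / 2))" using assms(1) by blast
    also have "\<dots> \<le> ennreal r" by (intro ennreal_leI) simp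
    finally show ?thesis using real by simp
  qed simp
qed

text \<open>For \<open>\<epsilon> < 1/2\<close> choose a ball of \<open>P\<close>-mass close to \<open>1\<close>. Every \<open>\<epsilon>\<close>-contamination still gives it
  more than half of the mass, so the means of \<open>P\<close> and of all contaminations stay in one common ball.\<close>

lemma breakdown_bounded_slope_ge:
  fixes P :: "'a::hadamard_space measure"
  assumes \<tau>: "\<tau> \<in> S0plus" and L: "(slope \<tau> \<longlongrightarrow> L) at_top" and P: "P \<in> P_tau' \<tau>"
  shows "ennreal (1 / 2) \<le> breakdown_point P delta_sup (P_tau' \<tau>) (frechet_means \<tau> z)"
  unfolding breakdown_point_def
proof (rule Inf_greatest, clarify)
  let ?M = "frechet_means \<tau> z"
  fix \<epsilon> :: real assume \<epsilon>: "\<epsilon> > 0"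
    and inf: "Sup {delta_sup (?M P) (?M Pt) | Pt. Pt \<in> P_tau' \<tau> \<and> contamination \<epsilon> P Pt} = \<infinity>"
  note P' = P_tau'_sets[OF P] P_tau'_prob[OF P]
  interpret prob_space P by (rule P')
  show "ennreal (1 / 2) \<le> ennreal \<epsilon>"
  proof (rule ccontr)
    assume "\<not> ?thesis"
    then have \<epsilon>2: "\<epsilon> < 1 / 2" using \<epsilon> by (metis ennreal_leI not_le)
    \<comment> \<open>The means are to be trapped with outside mass \<open>\<kappa>\<close> between \<open>\<epsilon>\<close> and \<open>1/2\<close>: contamination adds at most \<open>\<epsilon>\<close>.\<close>
    define \<kappa> where "\<kappa> = (\<epsilon> + 1 / 2) / 2"
    have \<kappa>: "\<kappa> < 1 / 2" "\<epsilon> < \<kappa>" using \<epsilon>2 by (auto simp: \<kappa>_def)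
    obtain R where R: "0 \<le> R" "measure P {y. R < dist y z} < \<kappa> - \<epsilon>"
      using small_tail[OF P'(1), of "\<lambda>_. 1" "\<kappa> - \<epsilon>" z] \<kappa> sets_eq_imp_space_eq[OF P'(1)] by auto
    obtain a where a: "0 \<le> a" "\<kappa> * L < (1 - \<kappa>) * slope \<tau> a"
      using slope_above_fraction[OF \<tau> L \<kappa>(1)] by blast
    define K where "K = (slope \<tau> a * (R + a) + \<tau> R) / ((1 - \<kappa>) * slope \<tau> a - \<kappa> * L)"
    have near: "dist z q \<le> K" if "Q \<in> P_tau' \<tau>" "measure Q {y. R < dist y z} \<le> \<kappa>" "q \<in> ?M Q" for Q q
      unfolding K_def using frechet_mean_near_majority[OF \<tau> that(1) R(1) a(1) slope_le_limit[OF \<tau> L] that(2) a(2) that(3)] .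
    have "Sup {delta_sup (?M P) (?M Pt) | Pt. Pt \<in> P_tau' \<tau> \<and> contamination \<epsilon> P Pt} \<le> ennreal (2 * K)"
    proof (rule Sup_least, clarify)
      fix Q assume Q: "Q \<in> P_tau' \<tau>" "contamination \<epsilon> P Q"
      have "measure Q {y. R < dist y z} \<le> \<kappa>"
        using contamination_measure_le[OF P' Q(2), of "{y. R < dist y z}"] R(2) sets_dist_greater[OF P'(1), of R z] P'(1)
        by simp
      note nearQ = near[OF Q(1) this]
      have "measure P {y. R < dist y z} \<le> \<kappa>" using R(2) \<epsilon> by simp
      note nearP = near[OF P this]
      show "delta_sup (?M P) (?M Q) \<le> ennreal (2 * K)"
        unfolding delta_sup_def
      proof (intro SUP_least ennreal_leI)
        fix p q assume "p \<in> ?M P" "q \<in> ?M Q"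
        then show "dist p q \<le> 2 * K" using nearP[of p] nearQ[of q] dist_triangle3[of p q z] by simp
      qed
    qed
    then show False using inf by (simp add: top_unique)
  qed
qed

text \<open>For \<open>\<epsilon> > 1/2\<close> the contaminating point \<open>x\<close> holds the majority itself: the radius \<open>R = 0\<close> about
  \<open>x\<close> leaves at most \<open>1 - \<epsilon> < 1/2\<close> outside. Hence the means stay within a distance of \<open>x\<close> that does not
  depend on \<open>x\<close>, and they escape together with it.\<close>

lemma breakdown_bounded_slope_le:
  fixes P :: "'a::hadamard_space measure"
  assumes unb: "ext_diameter (UNIV :: 'a set) = \<infinity>"
    and \<tau>: "\<tau> \<in> S0plus" and L: "(slope \<tau> \<longlongrightarrow> L) at_top" and P: "P \<in> P_tau' \<tau>"
  shows "breakdown_point P delta_sup (P_tau' \<tau>) (frechet_means \<tau> z) \<le> ennreal (1 / 2)"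
proof (rule ennreal_le_of_all_above)
  fix \<epsilon> :: real assume \<epsilon>: "1 / 2 < \<epsilon>" "\<epsilon> < 1"
  then have \<epsilon>0: "0 < \<epsilon>" by simp
  note pc = P_tau'_sets[OF P] P_tau'_prob[OF P] \<epsilon>0 \<epsilon>(2)
  interpret prob_space P by (rule pc)
  obtain a where a: "0 \<le> a" "(1 - \<epsilon>) * L < (1 - (1 - \<epsilon>)) * slope \<tau> a"
    using slope_above_fraction[OF \<tau> L, of "1 - \<epsilon>"] \<epsilon> by auto
  define K where "K = (slope \<tau> a * (0 + a) + \<tau> 0) / ((1 - (1 - \<epsilon>)) * slope \<tau> a - (1 - \<epsilon>) * L)"
  show "breakdown_point P delta_sup (P_tau' \<tau>) (frechet_means \<tau> z) \<le> ennreal \<epsilon>"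
  proof (rule breakdown_at_epsilon[OF \<tau> P \<epsilon>0 \<epsilon>(2)])
    fix p :: 'a and B :: real
    obtain x where x: "B + K < dist x p" using unbounded_space[OF unb] by blast
    let ?Q = "point_contamination \<epsilon> x P"
    have "measure ?Q {y. 0 < dist y x} = (1 - \<epsilon>) * prob {y. 0 < dist y x}"
      using measure_point_contamination[OF pc, of "{y. 0 < dist y x}" x] sets_dist_greater[OF pc(1), of 0 x] pc(1) by simp
    also have "\<dots> \<le> 1 - \<epsilon>" using \<epsilon> prob_le_1 by (intro mult_left_le) auto
    finally have "measure ?Q {y. 0 < dist y x} \<le> 1 - \<epsilon>" .
    note near = frechet_mean_near_majority[OF \<tau> point_contamination_P_tau'[OF \<tau> P \<epsilon>0 \<epsilon>(2)] order_refl a(1)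
        slope_le_limit[OF \<tau> L] this a(2), folded K_def]
    show "\<exists>x. \<forall>q\<in>frechet_means \<tau> z (point_contamination \<epsilon> x P). B \<le> dist p q"
    proof (intro exI[of _ x] ballI)
      fix q assume "q \<in> frechet_means \<tau> z ?Q"
      from near[OF this] x show "B \<le> dist p q"
        using dist_triangle[of x p q] by (simp add: dist_commute)
    qed
  qed
qed auto

section \<open>Unbounded derivative\<close>

text \<open>Suppose that a mean \<open>q\<close> of the contaminated distribution stays in a fixed ball about \<open>p\<close> while \<open>x\<close> is
  far away. A step of length \<open>s \<le> 1\<close> from \<open>q\<close> towards \<open>x\<close> raises the cost under \<open>P\<close> by at most \<open>s * K\<close>, where
  \<open>K\<close> depends on the ball only, but lowers the cost at \<open>x\<close> by at least \<open>s\<close> times the derivative near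
  \<open>dist x q - 1\<close>, which is arbitrarily large. So the step pays off, for any weight \<open>\<epsilon>\<close> of \<open>x\<close>.\<close>

lemma breakdown_unbounded_slope:
  fixes P :: "'a::hadamard_space measure"
  assumes unb: "ext_diameter (UNIV :: 'a set) = \<infinity>"
    and \<tau>: "\<tau> \<in> S0plus" and lim: "filterlim (slope \<tau>) at_top at_top" and P: "P \<in> P_tau' \<tau>"
  shows "breakdown_point P delta_sup (P_tau' \<tau>) (frechet_means \<tau> z) \<le> ennreal 0"
proof (rule ennreal_le_of_all_above)
  fix \<epsilon> :: real assume \<epsilon>: "0 < \<epsilon>" "\<epsilon> < 1"
  note pc = P_tau'_sets[OF P] P_tau'_prob[OF P] \<epsilon>
  interpret prob_space P by (rule pc)
  show "breakdown_point P delta_sup (P_tau' \<tau>) (frechet_means \<tau> z) \<le> ennreal \<epsilon>"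
  proof (rule breakdown_at_epsilon[OF \<tau> P \<epsilon>])
    fix p :: 'a and B :: real
    \<comment> \<open>The extra \<open>1\<close> leaves room for one step of length at most \<open>1\<close> within the ball.\<close>
    define r where "r = max B 0 + 1"
    define K where "K = 3 * ((\<integral>y. slope \<tau> (dist y p) \<partial>P) + slope \<tau> r)"
    have K: "0 \<le> K" unfolding K_def using slope_nonneg[OF \<tau>] by (intro mult_nonneg_nonneg add_nonneg_nonneg) auto
    obtain t where t: "K / \<epsilon> < slope \<tau> t" "0 \<le> t"
    proof -
      have "eventually (\<lambda>t. K / \<epsilon> < slope \<tau> t \<and> 0 \<le> t) at_top"
        using lim by (intro eventually_conj eventually_ge_at_top) (simp add: filterlim_at_top_dense)
      then show ?thesis using that by (auto simp: eventually_at_top_linorder)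
    qed
    obtain x where x: "t + 1 + r < dist x p" using unbounded_space[OF unb] by blast
    let ?Q = "point_contamination \<epsilon> x P"
    have Q: "?Q \<in> P_tau' \<tau>" by (rule point_contamination_P_tau'[OF \<tau> P \<epsilon>])
    show "\<exists>x. \<forall>q\<in>frechet_means \<tau> z (point_contamination \<epsilon> x P). B \<le> dist p q"
    proof (intro exI[of _ x] ballI, rule ccontr)
      fix q assume q: "q \<in> frechet_means \<tau> z ?Q" and "\<not> B \<le> dist p q"
      then have qp: "dist q p \<le> r - 1" by (auto simp: r_def dist_commute)
      define D where "D = dist q x"
      have D: "t + 1 < D" using x qp dist_triangle[of x p q] by (simp add: D_def dist_commute r_def)
      obtain k where k: "D < 2 ^ k" using real_arch_pow[of 2 D] by auto
      define s where "s = D / 2 ^ k"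
      have s: "0 < s" "s \<le> 1" using D t k by (auto simp: s_def divide_le_eq)
      obtain m where m: "dist q m \<le> s" "dist x m \<le> D - s"
        using partial_geodesic[of q x k] by (auto simp: s_def D_def)
      have "\<tau> (dist y m) - \<tau> (dist y q) \<le> s * (3 * (slope \<tau> (dist y p) + slope \<tau> r))" for y
      proof -
        have d: "\<bar>dist y m - dist y q\<bar> \<le> s"
          using m(1) dist_triangle[of y m q] dist_triangle[of y q m] by (auto simp: dist_commute)
        have "dist y q \<le> dist y p + (r - 1)" using qp dist_triangle[of y q p] by (simp add: dist_commute)
        then have "\<bar>\<tau> (dist y m) - \<tau> (dist y q)\<bar> \<le> slope \<tau> (dist y p + r) * \<bar>dist y m - dist y q\<bar>"
          using d s by (intro S0plus_lipschitz[OF \<tau>]) auto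
        also have "\<dots> \<le> (3 * (slope \<tau> (dist y p) + slope \<tau> r)) * s"
          using slope_nonneg[OF \<tau>] s d by (intro mult_mono slope_add[OF \<tau>]) auto
        finally show ?thesis by (simp add: mult.commute)
      qed
      then have "cost_diff \<tau> P m q \<le> (\<integral>y. s * (3 * (slope \<tau> (dist y p) + slope \<tau> r)) \<partial>P)"
        unfolding cost_diff_def using integrable_slope_dist[OF \<tau> P]
        by (intro integral_mono integrable_cost_diff[OF \<tau> P]) auto
      also have "\<dots> = s * K" using integrable_slope_dist[OF \<tau> P] by (simp add: K_def prob_space)
      finally have loss: "cost_diff \<tau> P m q \<le> s * K" .
      have "slope \<tau> t * s \<le> slope \<tau> (D - s) * s"
        using D s by (intro mult_right_mono monoD[OF slope_mono[OF \<tau>]]) auto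
      moreover have "\<tau> (D - s) + slope \<tau> (D - s) * s \<le> \<tau> D"
        using S0plus_subgradient[OF \<tau>, of D "D - s"] D s t by simp
      moreover have "\<tau> (dist x m) \<le> \<tau> (D - s)" using m(2) by (intro S0plus_mono[OF \<tau>]) auto
      ultimately have gain: "\<tau> (dist x m) - \<tau> (dist x q) \<le> - (slope \<tau> t * s)"
        by (simp add: D_def dist_commute)
      have "0 \<le> cost_diff \<tau> ?Q m q" using q frechet_means_iff[OF \<tau> Q] by blast
      also have "\<dots> = \<epsilon> * (\<tau> (dist x m) - \<tau> (dist x q)) + (1 - \<epsilon>) * cost_diff \<tau> P m q"
        unfolding cost_diff_def
        by (rule integral_point_contamination[OF pc]) (rule integrable_cost_diff[OF \<tau>], rule P Q)+
      also have "\<dots> \<le> \<epsilon> * (- (slope \<tau> t * s)) + 1 * (s * K)"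
      proof (rule add_mono)
        show "\<epsilon> * (\<tau> (dist x m) - \<tau> (dist x q)) \<le> \<epsilon> * (- (slope \<tau> t * s))"
          using gain \<epsilon> by (intro mult_left_mono) auto
        have "(1 - \<epsilon>) * cost_diff \<tau> P m q \<le> (1 - \<epsilon>) * (s * K)" using loss \<epsilon> by (intro mult_left_mono) auto
        also have "\<dots> \<le> 1 * (s * K)" using \<epsilon> s K by (intro mult_right_mono) auto
        finally show "(1 - \<epsilon>) * cost_diff \<tau> P m q \<le> 1 * (s * K)" .
      qed
      also have "\<dots> = s * (K - \<epsilon> * slope \<tau> t)" by (simp add: algebra_simps)
      also have "\<dots> < 0" using s t(1) \<epsilon> by (intro mult_pos_neg) (auto simp: pos_divide_less_eq mult.commute)
      finally show False by simp
    qed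
  qed
qed auto

theorem theorem4p7:
  fixes \<tau> :: "real \<Rightarrow> real" and z :: "'a::hadamard_space"
  assumes "ext_diameter (UNIV :: 'a set) = \<infinity>"
    and "\<tau> \<in> S0plus"
  shows "((\<exists>L. (tau_deriv \<tau> \<longlongrightarrow> L) at_top) \<longrightarrow>
            (P_tau' \<tau> :: 'a measure set) = P0 \<and>
            (\<forall>P \<in> P0. breakdown_point P delta_sup P0 (frechet_means \<tau> z) = ennreal (1 / 2))) \<and>
         (filterlim (tau_deriv \<tau>) at_top at_top \<longrightarrow>
            (\<forall>P \<in> P_tau' \<tau>. breakdown_point P delta_sup (P_tau' \<tau>) (frechet_means \<tau> z) = 0))"
proof (intro conjI impI)
  note unb = assms(1) and \<tau> = assms(2)
  have ev: "eventually (\<lambda>x. tau_deriv \<tau> x = slope \<tau> x) at_top"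
    using eventually_gt_at_top[of 0] by (rule eventually_mono) (rule tau_deriv_eq_slope)
  {
    assume "\<exists>L. (tau_deriv \<tau> \<longlongrightarrow> L) at_top"
    then obtain L where L: "(slope \<tau> \<longlongrightarrow> L) at_top" using tendsto_cong[OF ev] by blast
    show eq: "(P_tau' \<tau> :: 'a measure set) = P0" by (rule P_tau'_eq_P0[OF slope_le_limit[OF \<tau> L]])
    show "\<forall>P \<in> P0. breakdown_point P delta_sup P0 (frechet_means \<tau> z) = ennreal (1 / 2)"
      unfolding eq[symmetric]
      by (intro ballI antisym breakdown_bounded_slope_le[OF unb \<tau> L] breakdown_bounded_slope_ge[OF \<tau> L])
  }
  assume "filterlim (tau_deriv \<tau>) at_top at_top"
  then have "filterlim (slope \<tau>) at_top at_top" using filterlim_cong[OF refl refl ev] by blast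
  from breakdown_unbounded_slope[OF unb \<tau> this]
  show "\<forall>P \<in> P_tau' \<tau>. breakdown_point P delta_sup (P_tau' \<tau>) (frechet_means \<tau> z) = 0"
    by (simp add: le_zero_eq)
qed

end
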